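(* For every positive integer $s$, there exists a finite simple graph $G$ with nonempty vertex set that possesses precisely $s$ irreducible FAT colorings (FAT colorings being regarded as partitions of $V(G)$ into nonempty color classes).
   Context: All graphs are simple (undirected, no loops, no multiple edges) with finite, nonempty vertex set; they need not be connected and may have isolated vertices. For a vertex $v$ of a graph $G$, $\deg(v)$ denotes the number of neighbors of $v$, and for $S\subseteq V(G)$, $e(v,S)$ denotes the number of vertices of $S$ adjacent to $v$. A vertex coloring of $G$ is identified with the partition $\{V_1,\dots,V_k\}$ of $V(G)$ into its nonempty color classes (labels of colors are irrelevant); a partition of a set is a collection of nonempty, pairwise disjoint subsets whose union is the set. Adjacent vertices are allowed to lie in the same class. A vertex coloring of $G$ with nonempty color classes $V_1,\dots,V_k$ is a FAT $k$-coloring (Fair And Tolerant) if there exist real numbers $\alpha,\beta\in[0,1]$ such that for every vertex $v\in V(G)$ and every $i\in\{1,\dots,k\}$, $$e(v,V_i)=\begin{cases}\alpha\deg(v) & \text{if } v\notin V_i,\\ \beta\deg(v) & \text{if } v\in V_i.\end{cases}$$ A FAT coloring is a FAT $k$-coloring for some positive integer $k$. For two partitions $X,Y$ of the same set, $X$ is finer than $Y$ (equivalently, $Y$ is coarser than $X$) if every element of $Y$ is a union of some elements of $X$; $Y$ is strictly coarser than $X$ if in addition $X\neq Y$. The coarsening order on the set of all FAT colorings of $G$ is defined by $X\preceq Y$ if and only if $X$ is coarser than $Y$. A FAT coloring of $G$ is irreducible if it is maximal with respect to $\preceq$, i.e. it is not strictly coarser than any other FAT coloring of $G$. *)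

theory Defs
  imports Complex_Main "HOL-Library.Disjoint_Sets" "Graph_Theory.Pair_Digraph"
begin

text \<open>
  A finite simple graph is a \<open>pair_graph\<close>: a finite vertex set together with a symmetric and
  irreflexive set of ordered pairs of vertices, each undirected edge appearing as both of its
  orientations. The empty vertex set is permitted by \<open>pair_graph\<close>, so nonemptiness has to be
  assumed separately.
\<close>

definition edges_to :: "'a pair_pre_digraph \<Rightarrow> 'a \<Rightarrow> 'a set \<Rightarrow> nat" where
  "edges_to G v S = card {w \<in> S. (v, w) \<in> parcs G}"

definition deg :: "'a pair_pre_digraph \<Rightarrow> 'a \<Rightarrow> nat" where
  "deg G v = card {w \<in> pverts G. (v, w) \<in> parcs G}"

definition fat_k_coloring :: "'a pair_pre_digraph \<Rightarrow> nat \<Rightarrow> 'a set set \<Rightarrow> bool" where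
  "fat_k_coloring G k P \<longleftrightarrow>
     partition_on (pverts G) P \<and> card P = k \<and>
     (\<exists>\<alpha>\<in>{0..1::real}. \<exists>\<beta>\<in>{0..1::real}. \<forall>v\<in>pverts G. \<forall>V\<in>P.
        real (edges_to G v V) = (if v \<notin> V then \<alpha> * real (deg G v) else \<beta> * real (deg G v)))"

definition fat_coloring :: "'a pair_pre_digraph \<Rightarrow> 'a set set \<Rightarrow> bool" where
  "fat_coloring G P \<longleftrightarrow> (\<exists>k>0. fat_k_coloring G k P)"

text \<open>Only meaningful when both arguments are partitions of the same set.\<close>

definition coarser :: "'a set set \<Rightarrow> 'a set set \<Rightarrow> bool" where
  "coarser Y X \<longleftrightarrow> (\<forall>B\<in>Y. \<exists>\<A>\<subseteq>X. B = \<Union>\<A>)"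

lemma coarser_iff_refines:
  assumes X: "partition_on A X" and Y: "partition_on A Y"
  shows "coarser Y X \<longleftrightarrow> refines A X Y"
proof
  assume c: "coarser Y X"
  have "\<exists>B\<in>Y. C \<subseteq> B" if CX: "C \<in> X" for C
  proof -
    obtain a where a: "a \<in> C"
      using CX partition_onD3[OF X] by fastforce
    then have "a \<in> A"
      using CX partition_onD1[OF X] by blast
    then obtain B where B: "B \<in> Y" "a \<in> B"
      using partition_onD1[OF Y] by blast
    then obtain \<A> where \<A>: "\<A> \<subseteq> X" "B = \<Union>\<A>"
      using c unfolding coarser_def by blast
    then obtain D where D: "D \<in> \<A>" "a \<in> D"
      using B by blast
    then have "D = C"
      using X CX a \<A> partition_onD2[OF X] unfolding disjoint_def by blast
    then show ?thesis
      using B \<A> D by blast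
  qed
  then show "refines A X Y"
    using X Y unfolding refines_def by blast
next
  assume r: "refines A X Y"
  show "coarser Y X"
    unfolding coarser_def
  proof
    fix B assume B: "B \<in> Y"
    have "B = \<Union>{C \<in> X. C \<subseteq> B}"
    proof
      show "B \<subseteq> \<Union>{C \<in> X. C \<subseteq> B}"
      proof
        fix a assume a: "a \<in> B"
        then have "a \<in> A"
          using B partition_onD1[OF Y] by blast
        then obtain C where C: "C \<in> X" "a \<in> C"
          using partition_onD1[OF X] by blast
        then obtain D where D: "D \<in> Y" "C \<subseteq> D"
          using r unfolding refines_def by blast
        then have "D = B"
          using partition_onD2[OF Y] B a C unfolding disjoint_def by blast
        then show "a \<in> \<Union>{C \<in> X. C \<subseteq> B}"
          using C D by blast
      qed
    qed blast
    then show "\<exists>\<A>\<subseteq>X. B = \<Union>\<A>"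
      by (intro exI[of _ "{C \<in> X. C \<subseteq> B}"]) blast
  qed
qed

definition strictly_coarser :: "'a set set \<Rightarrow> 'a set set \<Rightarrow> bool" where
  "strictly_coarser Y X \<longleftrightarrow> coarser Y X \<and> X \<noteq> Y"

definition irreducible_fat_coloring :: "'a pair_pre_digraph \<Rightarrow> 'a set set \<Rightarrow> bool" where
  "irreducible_fat_coloring G P \<longleftrightarrow>
     fat_coloring G P \<and> \<not> (\<exists>Q. fat_coloring G Q \<and> strictly_coarser P Q)"

end

theory Submission
  imports Defs "HOL-Library.Nat_Bijection"
begin

text \<open>
  Take a connected non-bipartite graph \<open>H\<close> and erect a triangle with a new apex on every edge of
  \<open>H\<close>; call the result \<open>G\<close>. An apex has degree 2, so for any FAT coloring of \<open>G\<close> with at least two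
  classes the numbers \<open>2\<alpha>\<close> and \<open>2\<beta>\<close> are integers, and few cases are left. If \<open>\<alpha> = 0\<close>, no edge
  leaves a class, which contradicts connectedness. Otherwise the two ends of an edge of \<open>H\<close> never
  share a class: they would have to account for both neighbors of the apex, which forces \<open>\<alpha> = 0\<close> or
  \<open>\<beta> = 0\<close>, and the latter forbids edges inside a class. Two classes would then be a bipartition of
  \<open>H\<close>; so there are three, and the three corners of each erected triangle lie in different classes
  (\<open>fat_rainbow\<close>). Conversely such a rainbow partition is FAT with \<open>\<alpha> = 1/2\<close> and \<open>\<beta> = 0\<close>, because
  the neighborhood of a vertex is the disjoint union of its triangles, each of which contributes one
  neighbor to each foreign class (\<open>rainbow_fat\<close>).

  Hence, as soon as a rainbow partition exists, the irreducible FAT colorings are exactly the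
  rainbow partitions: they all have three classes, so none refines another, and any other
  FAT coloring has a single class, which they refine. Since an apex receives the color that the ends of its
  edge leave over, rainbow partitions correspond to the proper 3-colorings of \<open>H\<close> up to a
  permutation of the colors. If \<open>H\<close> contains a triangle, the permutation can be removed by fixing
  the colors of that triangle (\<open>card_irreducible_fat_colorings\<close>).

  It remains to find an \<open>H\<close> with exactly \<open>s\<close> proper 3-colorings up to permutation. Take the
  path \<open>0, 1, \<dots>, n\<close>, make \<open>0, 1, 2\<close> a triangle, colored by \<open>0, 1, 2\<close>, and join every
  \<open>i \<ge> 3\<close> to \<open>i mod 3\<close>. This leaves the colors \<open>i + 1\<close> and \<open>i + 2\<close> (modulo 3) for \<open>i\<close>. A vertex of
  the second kind cannot be followed by one of the first kind, as \<open>i + 2 = (i + 1) + 1\<close>, while all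
  other successions are allowed. So a coloring is determined by the place where the second kind
  starts. The vertex 3 is of the first kind, because its neighbor 2 has color 2; this leaves
  \<open>n - 2\<close> colorings, and \<open>n = s + 2\<close> is the right choice.
\<close>

section \<open>Blocks of a partition\<close>

lemma partition_on_block_unique:
  assumes "partition_on A P" "B \<in> P" "C \<in> P" "x \<in> B" "x \<in> C"
  shows "B = C"
  using assms partition_onD2[OF assms(1)] unfolding disjoint_def by blast

lemma deg_eq_sum_edges_to:
  assumes P: "partition_on (pverts G) P" and fin: "finite (pverts G)"
  shows "deg G v = (\<Sum>B\<in>P. edges_to G v B)"
proof -
  have finP: "finite P"
    using finite_elements[OF fin P] .
  have finB: "finite B" if "B \<in> P" for B
    using that fin partition_onD1[OF P] by (metis Union_upper finite_subset)
  have "{w \<in> pverts G. (v, w) \<in> parcs G} = (\<Union>B\<in>P. {w \<in> B. (v, w) \<in> parcs G})"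
    using partition_onD1[OF P] by blast
  moreover have "card (\<Union>B\<in>P. {w \<in> B. (v, w) \<in> parcs G})
      = (\<Sum>B\<in>P. card {w \<in> B. (v, w) \<in> parcs G})"
    using finP finB partition_on_block_unique[OF P] by (subst card_UN_disjoint) auto
  ultimately show ?thesis
    by (simp add: deg_def edges_to_def)
qed

section \<open>Erecting a triangle on every edge\<close>

text \<open>
  The edges of the underlying graph \<open>H\<close> are given by a set \<open>E\<close> of pairs that contains each edge in
  one orientation only; the vertices of \<open>H\<close> are the members of \<open>Field E\<close>. The last assumption
  says that no set \<open>S\<close> is one side of a bipartition of \<open>H\<close>.
\<close>

locale erected_triangles =
  fixes E :: "('a \<times> 'a) set" and apex :: "'a \<times> 'a \<Rightarrow> 'a"
  assumes finite_E: "finite E"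
    and asym: "(u, v) \<in> E \<Longrightarrow> (v, u) \<notin> E"
    and inj_apex: "inj_on apex E"
    and apex_new: "e \<in> E \<Longrightarrow> apex e \<notin> Field E"
    and connected: "x \<in> Field E \<Longrightarrow> y \<in> Field E \<Longrightarrow> (x, y) \<in> (E \<union> E\<inverse>)\<^sup>*"
    and nonbipartite: "\<exists>(u, v)\<in>E. u \<in> S \<longleftrightarrow> v \<in> S"
begin

definition tri :: "'a \<times> 'a \<Rightarrow> 'a set" where
  "tri e = {fst e, snd e, apex e}"

definition V :: "'a set" where
  "V = (\<Union>e\<in>E. tri e)"

definition G :: "'a pair_pre_digraph" where
  "G = \<lparr>pverts = V, parcs = {(x, y). x \<noteq> y \<and> (\<exists>e\<in>E. x \<in> tri e \<and> y \<in> tri e)}\<rparr>"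

lemma pverts_G [simp]: "pverts G = V"
  by (simp add: G_def)

lemma parcs_G [simp]: "(x, y) \<in> parcs G \<longleftrightarrow> x \<noteq> y \<and> (\<exists>e\<in>E. x \<in> tri e \<and> y \<in> tri e)"
  by (simp add: G_def)

lemma E_nonempty: "E \<noteq> {}"
  using nonbipartite by blast

lemma finite_V: "finite V"
  using finite_E by (auto simp: V_def tri_def)

lemma V_nonempty: "V \<noteq> {}"
  using E_nonempty by (auto simp: V_def tri_def)

lemma tri_subset: "e \<in> E \<Longrightarrow> tri e \<subseteq> V"
  by (auto simp: V_def)

lemma V_eq: "V = Field E \<union> apex ` E"
  by (force simp: V_def tri_def Field_def)

lemma Field_fst: "e \<in> E \<Longrightarrow> fst e \<in> Field E" and Field_snd: "e \<in> E \<Longrightarrow> snd e \<in> Field E"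
  by (cases e; auto simp: Field_def)+

lemma tri_distinct:
  assumes "e \<in> E"
  shows "fst e \<noteq> snd e" "fst e \<noteq> apex e" "snd e \<noteq> apex e"
proof -
  show "fst e \<noteq> snd e"
    using assms asym[of "fst e" "snd e"] by (cases e) auto
  show "fst e \<noteq> apex e" "snd e \<noteq> apex e"
    using assms apex_new[of e] Field_fst[of e] Field_snd[of e] by auto
qed

lemma apex_in_tri:
  assumes "e \<in> E" "e' \<in> E" "apex e \<in> tri e'"
  shows "e' = e"
  using assms apex_new[of e] Field_fst[of e'] Field_snd[of e'] inj_onD[OF inj_apex, of e e']
  by (auto simp: tri_def)

text \<open>
  Erected triangles are edge-disjoint: an edge at an apex determines the triangle, and every other
  edge is the base of its triangle.
\<close>

lemma tri_unique:
  assumes e: "e \<in> E" "e' \<in> E" and xy: "x \<noteq> y" "x \<in> tri e" "y \<in> tri e" "x \<in> tri e'" "y \<in> tri e'"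
  shows "e = e'"
proof (cases "x = apex e \<or> y = apex e \<or> x = apex e' \<or> y = apex e'")
  case True
  then show ?thesis
    using apex_in_tri e xy by metis
next
  case False
  then have "x \<in> {fst e, snd e}" "y \<in> {fst e, snd e}" "x \<in> {fst e', snd e'}" "y \<in> {fst e', snd e'}"
    using xy by (auto simp: tri_def)
  with xy(1) have "e = e' \<or> e = (snd e', fst e')"
    by (cases e; cases e') auto
  then show ?thesis
    using asym[of "fst e'" "snd e'"] e by auto
qed

lemma parcs_subset: "parcs G \<subseteq> V \<times> V"
  by (auto simp: V_def)

lemma pair_graph_G: "pair_graph G"
proof unfold_locales
  show "fst e \<in> pverts G" "snd e \<in> pverts G" if "e \<in> parcs G" for e
    using subsetD[OF parcs_subset that] by (simp_all add: mem_Times_iff)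
  show "finite (pverts G)"
    using finite_V by simp
  show "finite (parcs G)"
    using finite_V by (intro finite_subset[OF parcs_subset]) simp
  show "fst e \<noteq> snd e" if "e \<in> parcs G" for e
    using that by (cases e) simp
  show "symmetric G"
    unfolding symmetric_def with_proj_simps
  proof (rule symI)
    show "(y, x) \<in> parcs G" if "(x, y) \<in> parcs G" for x y
      using that unfolding parcs_G by metis
  qed
qed

lemma closed_under_tri:
  assumes closed: "\<And>e. e \<in> E \<Longrightarrow> tri e \<inter> S \<noteq> {} \<Longrightarrow> tri e \<subseteq> S" and "x \<in> S" "x \<in> V"
  shows "V \<subseteq> S"
proof -
  obtain e where e: "e \<in> E" "x \<in> tri e"
    using \<open>x \<in> V\<close> by (auto simp: V_def)
  then have "fst e \<in> S"
    using closed[of e] \<open>x \<in> S\<close> by (auto simp: tri_def)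
  have step: "v \<in> S" if "u \<in> S" "(u, v) \<in> E \<union> E\<inverse>" for u v
    using that closed[of "(u, v)"] closed[of "(v, u)"] by (auto simp: tri_def)
  have "tri e' \<subseteq> S" if e': "e' \<in> E" for e'
  proof -
    have "(fst e, fst e') \<in> (E \<union> E\<inverse>)\<^sup>*"
      using connected e e' Field_fst by blast
    then have "fst e' \<in> S"
      by (induction rule: rtrancl_induct) (use \<open>fst e \<in> S\<close> step in auto)
    then show ?thesis
      using closed[of e'] e' by (auto simp: tri_def)
  qed
  then show ?thesis
    by (auto simp: V_def)
qed

section \<open>The FAT colorings\<close>

definition rainbow :: "'a set set \<Rightarrow> bool" where
  "rainbow P \<longleftrightarrow> partition_on V P \<and> card P = 3 \<and> (\<forall>e\<in>E. \<forall>B\<in>P. \<exists>!x. x \<in> tri e \<inter> B)"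

text \<open>
  A vertex \<open>v\<close> has no neighbor in its own class. In each of the two other classes it has exactly one
  neighbor per triangle through \<open>v\<close>, and different triangles yield different neighbors; so it has
  the same number of neighbors in both, which is half of its degree.
\<close>

lemma rainbow_fat:
  assumes "rainbow P"
  shows "fat_coloring G P"
proof -
  have P: "partition_on V P" and card: "card P = 3"
    and ex1: "\<And>e B. e \<in> E \<Longrightarrow> B \<in> P \<Longrightarrow> \<exists>!x. x \<in> tri e \<inter> B"
    using assms by (auto simp: rainbow_def)
  define D where "D v = card {e \<in> E. v \<in> tri e}" for v
  have own: "edges_to G v B = 0" if "v \<in> B" "B \<in> P" for v B
  proof -
    have "{w \<in> B. (v, w) \<in> parcs G} = {}"
      using that ex1 by fastforce
    then show ?thesis
      by (simp only: edges_to_def card.empty)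
  qed
  have other: "edges_to G v B = D v" if B: "v \<notin> B" "B \<in> P" for v B
  proof -
    \<comment> \<open>the corner of the triangle that lies in \<open>B\<close>\<close>
    define g where "g e = (THE x. x \<in> tri e \<inter> B)" for e
    have g: "g e \<in> tri e \<inter> B" if "e \<in> E" for e
      unfolding g_def by (rule theI') (use ex1 that B in auto)
    have g_eq: "g e = x" if "e \<in> E" "x \<in> tri e" "x \<in> B" for e x
      using ex1[OF that(1) B(2)] g[OF that(1)] that by auto
    have "bij_betw g {e \<in> E. v \<in> tri e} {w \<in> B. (v, w) \<in> parcs G}"
      unfolding bij_betw_def
    proof
      show "inj_on g {e \<in> E. v \<in> tri e}"
        by (rule inj_onI) (use g B tri_unique in \<open>smt (verit) IntD1 IntD2 mem_Collect_eq\<close>)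
      show "g ` {e \<in> E. v \<in> tri e} = {w \<in> B. (v, w) \<in> parcs G}"
      proof (intro equalityI subsetI)
        fix w assume "w \<in> g ` {e \<in> E. v \<in> tri e}"
        then obtain e where e: "e \<in> E" "v \<in> tri e" "w = g e"
          by blast
        moreover from this have "w \<noteq> v"
          using g[OF e(1)] B(1) by auto
        ultimately show "w \<in> {w \<in> B. (v, w) \<in> parcs G}"
          using g[OF e(1)] by auto
      next
        fix w assume "w \<in> {w \<in> B. (v, w) \<in> parcs G}"
        then obtain e where "e \<in> E" "v \<in> tri e" "w \<in> tri e" "w \<in> B"
          by auto
        then show "w \<in> g ` {e \<in> E. v \<in> tri e}"
          using g_eq[of e w] by blast
      qed
    qed
    from bij_betw_same_card[OF this] show ?thesis
      by (simp only: edges_to_def D_def)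
  qed
  have deg: "deg G v = 2 * D v" if v: "v \<in> V" for v
  proof -
    obtain A where A: "A \<in> P" "v \<in> A"
      using v partition_onD1[OF P] by blast
    have "deg G v = (\<Sum>B\<in>P. edges_to G v B)"
      using P finite_V by (intro deg_eq_sum_edges_to) auto
    also have "\<dots> = edges_to G v A + (\<Sum>B\<in>P-{A}. edges_to G v B)"
      using A finite_elements[OF finite_V P] by (simp add: sum.remove)
    also have "(\<Sum>B\<in>P-{A}. edges_to G v B) = (\<Sum>B\<in>P-{A}. D v)"
      using partition_on_block_unique[OF P] A by (intro sum.cong refl other) auto
    finally show ?thesis
      using own[OF A(2,1)] card A by simp
  qed
  have "fat_k_coloring G 3 P"
    unfolding fat_k_coloring_def
  proof (intro conjI bexI ballI)
    show "real (edges_to G v B)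
        = (if v \<notin> B then 1 / 2 * real (deg G v) else 0 * real (deg G v))"
      if "v \<in> pverts G" "B \<in> P" for v B
      using that own[of v B] other[of v B] deg[of v] by simp
  qed (use P card in auto)
  then show ?thesis
    unfolding fat_coloring_def by (intro exI[of _ 3]) simp
qed

lemma edges_to_apex:
  assumes e: "e \<in> E"
  shows "edges_to G (apex e) S = of_bool (fst e \<in> S) + of_bool (snd e \<in> S)"
proof -
  have "{w \<in> S. (apex e, w) \<in> parcs G} = {fst e, snd e} \<inter> S"
    using e tri_distinct[OF e] apex_in_tri[OF e] by (auto simp: tri_def)
  then show ?thesis
    unfolding edges_to_def using tri_distinct[OF e] by auto
qed

lemma deg_apex:
  assumes e: "e \<in> E"
  shows "deg G (apex e) = 2"
proof -
  have "deg G (apex e) = edges_to G (apex e) V"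
    by (simp add: deg_def edges_to_def)
  then show ?thesis
    using edges_to_apex[OF e] tri_subset[OF e] by (simp add: tri_def)
qed

lemma edges_to_pos:
  assumes "e \<in> E" "x \<in> tri e" "y \<in> tri e" "x \<noteq> y" "y \<in> S" "S \<subseteq> V"
  shows "edges_to G x S > 0"
proof -
  have "finite {w \<in> S. (x, w) \<in> parcs G}"
    using finite_subset[OF assms(6) finite_V] by auto
  moreover have "y \<in> {w \<in> S. (x, w) \<in> parcs G}"
    using assms by auto
  ultimately show ?thesis
    unfolding edges_to_def using card_gt_0_iff by blast
qed

text \<open>
  The fairness condition is evaluated almost exclusively at the apexes, where the two base vertices
  are the only neighbors.
\<close>

lemma fat_rainbow:
  assumes fat: "fat_coloring G P" and nontriv: "P \<noteq> {V}"
  shows "rainbow P"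
proof -
  obtain \<alpha> \<beta> :: real where P: "partition_on V P"
    and fair: "\<And>v B. v \<in> V \<Longrightarrow> B \<in> P \<Longrightarrow>
      real (edges_to G v B) = (if v \<notin> B then \<alpha> * real (deg G v) else \<beta> * real (deg G v))"
    using fat by (auto simp: fat_coloring_def fat_k_coloring_def)
  have block: "B \<subseteq> V" "B \<noteq> {}" if "B \<in> P" for B
    using that P by (auto simp: partition_on_def)
  note uniq = partition_on_block_unique[OF P]
  have cover: "\<exists>B\<in>P. x \<in> B" if "x \<in> V" for x
    using that partition_onD1[OF P] by blast
  have other_block: "\<exists>B\<in>P. B \<noteq> A" if "A \<in> P" for A
  proof (rule ccontr)
    assume "\<not> ?thesis"
    then have "P = {A}"
      using that by blast
    moreover from this have "A = V"
      using partition_onD1[OF P] by simp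
    ultimately show False
      using nontriv by simp
  qed
  \<comment> \<open>With \<open>\<alpha> = 0\<close> every class is closed under adjacency, hence everything.\<close>
  have "\<alpha> \<noteq> 0"
  proof
    assume "\<alpha> = 0"
    obtain x where "x \<in> V"
      using V_nonempty by blast
    then obtain A where A: "A \<in> P" "x \<in> A"
      using cover by blast
    have "tri e \<subseteq> A" if e: "e \<in> E" "tri e \<inter> A \<noteq> {}" for e
    proof
      fix w assume w: "w \<in> tri e"
      obtain y where y: "y \<in> tri e" "y \<in> A"
        using e by blast
      obtain C where C: "C \<in> P" "w \<in> C"
        using cover w tri_subset e by blast
      have "y \<in> C"
      proof (rule ccontr)
        assume "y \<notin> C"
        moreover have "y \<in> V"
          using y e tri_subset by blast
        ultimately have "edges_to G y C = 0"
          using fair[of y C] C \<open>\<alpha> = 0\<close> by simp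
        moreover have "edges_to G y C > 0"
          using edges_to_pos[OF e(1) y(1) w _ C(2) block(1)[OF C(1)]] C \<open>y \<notin> C\<close> by blast
        ultimately show False
          by simp
      qed
      then show "w \<in> A"
        using uniq A C y by blast
    qed
    then have "V \<subseteq> A"
      using closed_under_tri A \<open>x \<in> V\<close> by blast
    moreover obtain B where B: "B \<in> P" "B \<noteq> A"
      using other_block[OF A(1)] by blast
    moreover obtain z where "z \<in> B"
      using block(2)[OF B(1)] by blast
    ultimately have "z \<in> A"
      using block(1)[OF B(1)] by blast
    then show False
      using uniq[OF A(1) B(1) _ \<open>z \<in> B\<close>] B(2) by simp
  qed
  have apex_own: "of_bool (fst e \<in> A) + of_bool (snd e \<in> A) = 2 * \<beta>"
    if "e \<in> E" "A \<in> P" "apex e \<in> A" for e A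
    using fair[of "apex e" A] that edges_to_apex[of e A] deg_apex[of e] tri_subset[of e]
    by (simp add: tri_def)
  have apex_other: "of_bool (fst e \<in> A) + of_bool (snd e \<in> A) = 2 * \<alpha>"
    if "e \<in> E" "A \<in> P" "apex e \<notin> A" for e A
    using fair[of "apex e" A] that edges_to_apex[of e A] deg_apex[of e] tri_subset[of e]
    by (simp add: tri_def)
  \<comment> \<open>A class \<open>U\<close> containing both ends of \<open>e\<close> leaves no neighbor of the apex to the other classes. If
    \<open>U\<close> is the class of the apex, this gives \<open>\<alpha> = 0\<close>; if not, \<open>\<beta> = 0\<close>, although \<open>e\<close> lies inside \<open>U\<close>.\<close>
  have separated: "snd e \<notin> U" if e: "e \<in> E" and U: "U \<in> P" "fst e \<in> U" for e U
  proof
    assume v: "snd e \<in> U"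
    obtain A where A: "A \<in> P" "apex e \<in> A"
      using cover e tri_subset[of e] by (auto simp: tri_def)
    show False
    proof (cases "U = A")
      case True
      obtain B where "B \<in> P" "B \<noteq> A"
        using other_block A by blast
      then have "apex e \<notin> B" "fst e \<notin> B" "snd e \<notin> B"
        using uniq A U v True by blast+
      then show False
        using apex_other[OF e \<open>B \<in> P\<close>] \<open>\<alpha> \<noteq> 0\<close> by simp
    next
      case False
      then have "fst e \<notin> A" "snd e \<notin> A"
        using uniq A U v by blast+
      then have "\<beta> = 0"
        using apex_own[OF e A] by simp
      then have "edges_to G (fst e) U = 0"
        using fair[of "fst e" U] U e tri_subset[OF e] by (auto simp: tri_def)
      moreover have "edges_to G (fst e) U > 0"
        using edges_to_pos[of e "fst e" "snd e" U] e U v block tri_distinct by (auto simp: tri_def)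
      ultimately show False
        by simp
    qed
  qed
  have meets: "fst e \<in> A \<or> snd e \<in> A \<or> apex e \<in> A" if "e \<in> E" "A \<in> P" for e A
    by (rule ccontr) (use apex_other[OF that] \<open>\<alpha> \<noteq> 0\<close> in simp)
  \<comment> \<open>Two classes would be a bipartition of \<open>H\<close>.\<close>
  have not_two: "\<not> (P = {U, W})" for U W
  proof
    assume two: "P = {U, W}"
    obtain u v where uv: "(u, v) \<in> E" "u \<in> U \<longleftrightarrow> v \<in> U"
      using nonbipartite[of U] by blast
    moreover have "u \<in> V" "v \<in> V"
      using tri_subset[OF uv(1)] by (auto simp: tri_def)
    ultimately show False
      using separated[OF uv(1), of U] separated[OF uv(1), of W] cover[of u] cover[of v] two by auto
  qed
  have three: "\<exists>A U W. P = {A, U, W} \<and> A \<noteq> U \<and> A \<noteq> W \<and> U \<noteq> W \<and> apex e \<in> A \<and> fst e \<in> U \<and> snd e \<in> W"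
    if e: "e \<in> E" for e
  proof -
    obtain A U W where blocks: "A \<in> P" "apex e \<in> A" "U \<in> P" "fst e \<in> U" "W \<in> P" "snd e \<in> W"
      using cover tri_subset[OF e] by (auto simp: tri_def) metis
    have "U \<noteq> W"
      using separated e blocks by blast
    have "B \<in> {A, U, W}" if "B \<in> P" for B
      using meets[OF e that] uniq that blocks by blast
    then have "P = {A, U, W}"
      using blocks by blast
    moreover have "A \<noteq> U" "A \<noteq> W"
      using not_two[of U W] not_two[of U A] calculation by auto
    ultimately show ?thesis
      using blocks \<open>U \<noteq> W\<close> by blast
  qed
  have "card P = 3"
  proof -
    obtain e where "e \<in> E"
      using E_nonempty by blast
    then obtain A U W where "P = {A, U, W}" "A \<noteq> U" "A \<noteq> W" "U \<noteq> W"
      using three by meson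
    then show ?thesis
      by simp
  qed
  moreover have "\<exists>!x. x \<in> tri e \<inter> B" if e: "e \<in> E" and B: "B \<in> P" for e B
  proof -
    obtain A U W where AUW: "P = {A, U, W}" "A \<noteq> U" "A \<noteq> W" "U \<noteq> W"
      "apex e \<in> A" "fst e \<in> U" "snd e \<in> W"
      using three[OF e] by (elim exE conjE) (rule that)
    then have "apex e \<notin> U" "apex e \<notin> W" "fst e \<notin> A" "fst e \<notin> W" "snd e \<notin> A" "snd e \<notin> U"
      using uniq by blast+
    then show ?thesis
      using AUW B by (auto simp: tri_def)
  qed
  ultimately show ?thesis
    using P by (simp add: rainbow_def)
qed

text \<open>
  If a class of \<open>P\<close> contained two classes of \<open>Q\<close>, it would meet every triangle at least twice.
\<close>

lemma rainbow_not_refinable: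
  assumes P: "rainbow P" and Q: "rainbow Q" and c: "coarser P Q"
  shows "P = Q"
proof -
  obtain e where e: "e \<in> E"
    using E_nonempty by blast
  have "P \<subseteq> Q"
  proof
    fix B assume B: "B \<in> P"
    then obtain \<A> where \<A>: "\<A> \<subseteq> Q" "B = \<Union>\<A>"
      using c by (auto simp: coarser_def)
    moreover have "B \<noteq> {}"
      using B P by (auto simp: rainbow_def partition_on_def)
    ultimately obtain C where C: "C \<in> \<A>"
      by blast
    have "D = C" if D: "D \<in> \<A>" for D
    proof -
      have in_Q: "C \<in> Q" "D \<in> Q"
        using C D \<A>(1) by auto
      then have "\<exists>x. x \<in> tri e \<inter> C" "\<exists>y. y \<in> tri e \<inter> D"
        using Q e unfolding rainbow_def by metis+
      then obtain x y where xy: "x \<in> tri e" "x \<in> C" "y \<in> tri e" "y \<in> D"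
        by auto
      moreover have "\<exists>!z. z \<in> tri e \<inter> B"
        using P e B unfolding rainbow_def by metis
      moreover have "x \<in> B" "y \<in> B"
        using xy C D \<A>(2) by auto
      ultimately have "x = y"
        by auto
      then show ?thesis
        using partition_on_block_unique[of V Q D C y] Q in_Q xy by (auto simp: rainbow_def)
    qed
    then have "\<A> = {C}"
      using C by blast
    then show "B \<in> Q"
      using \<A> by simp
  qed
  moreover have "finite Q" "card P = card Q"
    using P Q by (auto simp: rainbow_def intro: card_ge_0_finite)
  ultimately show ?thesis
    using card_subset_eq by blast
qed

lemma irreducible_iff_rainbow:
  assumes ex: "rainbow R"
  shows "irreducible_fat_coloring G P \<longleftrightarrow> rainbow P"
proof
  assume irr: "irreducible_fat_coloring G P"
  have R: "partition_on V R" "card R = 3"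
    using ex by (auto simp: rainbow_def)
  then have "coarser {V} R" "R \<noteq> {V}"
    by (auto simp: coarser_def partition_on_def)
  then have "P \<noteq> {V}"
    using irr rainbow_fat[OF ex] by (auto simp: irreducible_fat_coloring_def strictly_coarser_def)
  then show "rainbow P"
    using irr fat_rainbow by (auto simp: irreducible_fat_coloring_def)
next
  assume P: "rainbow P"
  have "\<not> strictly_coarser P Q" if "fat_coloring G Q" for Q
  proof
    assume "strictly_coarser P Q"
    then have c: "coarser P Q" and ne: "Q \<noteq> P"
      by (auto simp: strictly_coarser_def)
    then have "Q = {V}"
      using fat_rainbow[OF that] rainbow_not_refinable[OF P] by blast
    moreover have "{} \<notin> P"
      using P by (auto simp: rainbow_def partition_on_def)
    ultimately have "P \<subseteq> {V}"
      using c unfolding coarser_def by (metis Sup_empty ccpo_Sup_singleton insertCI subsetI subset_singletonD)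
    then have "card P \<le> 1"
      using card_mono[of "{V}" P] by simp
    then show False
      using P by (simp add: rainbow_def)
  qed
  then show "irreducible_fat_coloring G P"
    using rainbow_fat[OF P] by (auto simp: irreducible_fat_coloring_def)
qed

section \<open>Rainbow partitions as proper 3-colorings\<close>

definition classes :: "('a \<Rightarrow> nat) \<Rightarrow> 'a set set" where
  "classes f = (\<lambda>j. {x \<in> V. f x = j}) ` {0, 1, 2}"

text \<open>
  The colors \<open>0, 1, 2\<close> have sum 3, so the apex of an edge with two distinct colors gets the third one.
\<close>

definition extend :: "('a \<Rightarrow> nat) \<Rightarrow> 'a \<Rightarrow> nat" where
  "extend c x = (if x \<in> Field E then c x
     else 3 - c (fst (inv_into E apex x)) - c (snd (inv_into E apex x)))"

text \<open>
  Fixing the colors on a triangle \<open>p, q, r\<close> selects one representative of every orbit of proper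
  3-colorings under permutations of the colors.
\<close>

definition normalized_colorings :: "'a \<Rightarrow> 'a \<Rightarrow> 'a \<Rightarrow> ('a \<Rightarrow> nat) set" where
  "normalized_colorings p q r =
     {c \<in> Field E \<rightarrow>\<^sub>E {0, 1, 2}. (\<forall>(u, v)\<in>E. c u \<noteq> c v) \<and> c p = 0 \<and> c q = 1 \<and> c r = 2}"

lemma extend_apex:
  assumes "e \<in> E"
  shows "extend c (apex e) = 3 - c (fst e) - c (snd e)"
  using assms apex_new inv_into_f_f[OF inj_apex] by (simp add: extend_def)

lemma extend_tri:
  assumes c: "c \<in> Field E \<rightarrow> {0, 1, 2}" and ne: "c (fst e) \<noteq> c (snd e)" and e: "e \<in> E"
  shows "extend c ` tri e = {0, 1, 2}"
proof -
  have "c (fst e) \<in> {0, 1, 2}" "c (snd e) \<in> {0, 1, 2}"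
    using Pi_mem[OF c] e Field_fst Field_snd by blast+
  moreover have "extend c ` tri e = {c (fst e), c (snd e), 3 - c (fst e) - c (snd e)}"
    using Field_fst[OF e] Field_snd[OF e]
    unfolding tri_def image_insert extend_apex[OF e, of c] image_empty by (simp add: extend_def)
  moreover have "{a, b, 3 - a - b} = {0, 1, 2}"
    if "a \<in> {0, 1, 2}" "b \<in> {0, 1, 2}" "a \<noteq> b" for a b :: nat
    using that by (elim insertE emptyE) auto
  ultimately show ?thesis
    using ne by simp
qed

lemma classes_rainbow:
  assumes f: "\<And>e. e \<in> E \<Longrightarrow> f ` tri e = {0, 1, 2}"
  shows "rainbow (classes f)"
proof -
  obtain e0 where e0: "e0 \<in> E"
    using E_nonempty by blast
  have hit: "\<exists>x\<in>tri e. f x = j" if "e \<in> E" "j \<in> {0, 1, 2}" for e j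
    using f[OF that(1)] that(2) by (metis imageE)
  have nonempty: "{x \<in> V. f x = j} \<noteq> {}" if "j \<in> {0, 1, 2}" for j
    using hit[OF e0 that] tri_subset[OF e0] by blast
  have "f x \<in> {0, 1, 2}" if "x \<in> V" for x
    using that f unfolding V_def by blast
  then have "\<Union> (classes f) = V"
    unfolding classes_def by blast
  then have "partition_on V (classes f)"
  proof (rule partition_onI)
    show "{} \<notin> classes f"
      using nonempty unfolding classes_def by blast
    show "disjnt B C" if "B \<in> classes f" "C \<in> classes f" "B \<noteq> C" for B C
    proof -
      obtain i j where ij: "B = {x \<in> V. f x = i}" "C = {x \<in> V. f x = j}"
        using \<open>B \<in> classes f\<close> \<open>C \<in> classes f\<close> unfolding classes_def by blast
      then have "i \<noteq> j"
        using \<open>B \<noteq> C\<close> by blast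
      then show ?thesis
        by (auto simp: disjnt_def ij)
    qed
  qed
  moreover have "inj_on (\<lambda>j. {x \<in> V. f x = j}) {0, 1, 2}"
  proof (rule inj_onI)
    fix i j :: nat assume "i \<in> {0, 1, 2}" and eq: "{x \<in> V. f x = i} = {x \<in> V. f x = j}"
    then obtain x where "x \<in> {x \<in> V. f x = i}"
      using nonempty by blast
    moreover from this have "x \<in> {x \<in> V. f x = j}"
      using eq by simp
    ultimately show "i = j"
      by simp
  qed
  then have "card (classes f) = 3"
    by (simp add: classes_def card_image)
  moreover have "\<exists>!x. x \<in> tri e \<inter> B" if e: "e \<in> E" and B: "B \<in> classes f" for e B
  proof -
    obtain j where j: "j \<in> {0, 1, 2}" "B = {x \<in> V. f x = j}"
      using B by (auto simp: classes_def)
    have "card (tri e) = 3"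
      using tri_distinct[OF e] by (simp add: tri_def)
    then have "inj_on f (tri e)"
      using f[OF e] by (intro eq_card_imp_inj_on) (auto simp: tri_def)
    then show ?thesis
      using hit[OF e j(1)] j(2) tri_subset[OF e] by (auto dest: inj_onD)
  qed
  ultimately show ?thesis
    by (simp add: rainbow_def)
qed

text \<open>
  The normalized coloring is recovered from the partition because the color of a vertex is that of
  the corner among \<open>p, q, r\<close> in its class.
\<close>

lemma bij_betw_colorings_rainbow:
  assumes pqr: "(p, q) \<in> E" "(q, r) \<in> E" "(p, r) \<in> E"
  shows "bij_betw (\<lambda>c. classes (extend c)) (normalized_colorings p q r) {P. rainbow P}"
proof -
  have pqr_in: "p \<in> Field E" "q \<in> Field E" "r \<in> Field E"
    using pqr by (auto simp: Field_def)
  then have pqr_V: "p \<in> V" "q \<in> V" "r \<in> V"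
    by (auto simp: V_eq)
  have "inj_on (\<lambda>c. classes (extend c)) (normalized_colorings p q r)"
  proof (rule inj_onI)
    fix c d assume c: "c \<in> normalized_colorings p q r" and d: "d \<in> normalized_colorings p q r"
      and eq: "classes (extend c) = classes (extend d)"
    have "c x = d x" if x: "x \<in> Field E" for x
    proof -
      have "c x \<in> {0, 1, 2}"
        using c x PiE_mem unfolding normalized_colorings_def by fastforce
      moreover have "c p = 0" "c q = 1" "c r = 2"
        using c by (auto simp: normalized_colorings_def)
      ultimately obtain y where y: "y \<in> {p, q, r}" "c y = c x"
        by (metis insert_iff empty_iff)
      have "{z \<in> V. extend c z = c x} \<in> classes (extend d)"
        using \<open>c x \<in> {0, 1, 2}\<close> eq[symmetric] by (auto simp: classes_def)
      then obtain j where j: "{z \<in> V. extend c z = c x} = {z \<in> V. extend d z = j}"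
        by (auto simp: classes_def)
      have "y \<in> Field E"
        using y pqr_in by auto
      then have "x \<in> {z \<in> V. extend c z = c x}" "y \<in> {z \<in> V. extend c z = c x}"
        using x y(2) by (simp_all add: V_eq extend_def)
      then have "d x = d y"
        using x \<open>y \<in> Field E\<close> unfolding j by (simp add: extend_def)
      then show ?thesis
        using y c d by (auto simp: normalized_colorings_def)
    qed
    then show "c = d"
      using c d by (auto simp: normalized_colorings_def intro: PiE_ext)
  qed
  moreover have "rainbow (classes (extend c))" if "c \<in> normalized_colorings p q r" for c
  proof (rule classes_rainbow)
    have c: "c \<in> Field E \<rightarrow>\<^sub>E {0, 1, 2}" "\<forall>(u, v)\<in>E. c u \<noteq> c v"
      using that by (simp_all add: normalized_colorings_def)
    have "c \<in> Field E \<rightarrow> {0, 1, 2}"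
      using c(1) unfolding PiE_def by blast
    then show "extend c ` tri e = {0, 1, 2}" if "e \<in> E" for e
      using c(2) that by (intro extend_tri) auto
  qed
  moreover have "P \<in> (\<lambda>c. classes (extend c)) ` normalized_colorings p q r" if P: "rainbow P" for P
  proof -
    have part: "partition_on V P" and card: "card P = 3"
      and ex1: "\<And>e B. e \<in> E \<Longrightarrow> B \<in> P \<Longrightarrow> \<exists>!x. x \<in> tri e \<inter> B"
      using P by (auto simp: rainbow_def)
    note uniq = partition_on_block_unique[OF part]
    obtain B0 B1 B2 where B: "B0 \<in> P" "p \<in> B0" "B1 \<in> P" "q \<in> B1" "B2 \<in> P" "r \<in> B2"
      using pqr_V partition_onD1[OF part] by blast
    have sep: "\<not> (u \<in> B \<and> v \<in> B)" if "(u, v) \<in> E" "B \<in> P" for u v B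
      using ex1[OF that] tri_distinct(1)[OF that(1)] by (auto simp: tri_def)
    have dist: "B0 \<noteq> B1" "B1 \<noteq> B2" "B0 \<noteq> B2"
      using sep pqr B by blast+
    have "finite P"
      using card by (auto intro: card_ge_0_finite)
    then have P_eq: "P = {B0, B1, B2}"
      using card_subset_eq[of P "{B0, B1, B2}"] B dist card by auto
    have disj: "B0 \<inter> B1 = {}" "B1 \<inter> B2 = {}" "B0 \<inter> B2 = {}"
      using uniq B dist by blast+
    have V: "V = B0 \<union> B1 \<union> B2"
      using partition_onD1[OF part] P_eq by auto
    define f where "f x = (if x \<in> B0 then 0 else if x \<in> B1 then 1 else 2 :: nat)" for x
    have "{x \<in> V. f x = 0} = B0" "{x \<in> V. f x = 1} = B1" "{x \<in> V. f x = 2} = B2"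
      using V disj by (auto simp: f_def)
    then have P_classes: "P = classes f"
      by (simp add: classes_def P_eq)
    have f_block: "f x = f y \<longleftrightarrow> (\<exists>B\<in>P. x \<in> B \<and> y \<in> B)" if "x \<in> V" "y \<in> V" for x y
      using that V disj by (auto simp: f_def P_eq)
    have f_ne: "f x \<noteq> f y" if "e \<in> E" "x \<in> tri e" "y \<in> tri e" "x \<noteq> y" for e x y
      using that f_block[of x y] ex1 tri_subset by fastforce
    let ?c = "restrict f (Field E)"
    have "f x \<in> {0, 1, 2}" for x
      by (simp add: f_def)
    then have "?c \<in> Field E \<rightarrow>\<^sub>E {0, 1, 2}"
      by (intro restrict_PiE_iff[THEN iffD2] ballI)
    moreover have "?c u \<noteq> ?c v" if "(u, v) \<in> E" for u v
      using f_ne[OF that, of u v] tri_distinct(1)[OF that] Field_fst[OF that] Field_snd[OF that]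
      by (simp add: tri_def)
    moreover have "q \<notin> B0" "r \<notin> B0" "r \<notin> B1"
      using B disj by auto
    then have "?c p = 0" "?c q = 1" "?c r = 2"
      using pqr_in B by (simp_all add: f_def)
    ultimately have "?c \<in> normalized_colorings p q r"
      unfolding normalized_colorings_def by blast
    moreover have "extend ?c x = f x" if "x \<in> V" for x
    proof (cases "x \<in> Field E")
      case True
      then show ?thesis by (simp add: extend_def)
    next
      case False
      then obtain e where e: "e \<in> E" "x = apex e"
        using \<open>x \<in> V\<close> by (auto simp: V_eq)
      have "f (fst e) \<noteq> f (snd e)" "f x \<noteq> f (fst e)" "f x \<noteq> f (snd e)"
        using f_ne[OF e(1)] tri_distinct[OF e(1)] e(2) by (auto simp: tri_def)
      moreover have "f z \<in> {0, 1, 2}" for z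
        by (simp add: f_def)
      from this[of x] this[of "fst e"] this[of "snd e"] calculation
      have "f x = 3 - f (fst e) - f (snd e)"
        by auto
      ultimately show ?thesis
        using extend_apex[OF e(1), of ?c] Field_fst[OF e(1)] Field_snd[OF e(1)] e(2) by simp
    qed
    then have "classes (extend ?c) = classes f"
      unfolding classes_def by (intro image_cong refl) auto
    ultimately show ?thesis
      using P_classes by blast
  qed
  ultimately show ?thesis
    unfolding bij_betw_def by blast
qed

theorem card_irreducible_fat_colorings:
  assumes "(p, q) \<in> E" "(q, r) \<in> E" "(p, r) \<in> E" and "normalized_colorings p q r \<noteq> {}"
  shows "card {P. irreducible_fat_coloring G P} = card (normalized_colorings p q r)"
proof -
  note bij = bij_betw_colorings_rainbow[OF assms(1-3)]
  obtain R where "rainbow R"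
    using bij assms(4) by (auto simp: bij_betw_def)
  then have "{P. irreducible_fat_coloring G P} = {P. rainbow P}"
    using irreducible_iff_rainbow by blast
  then show ?thesis
    using bij_betw_same_card[OF bij] by simp
qed

end

section \<open>A graph with a prescribed number of 3-colorings\<close>

text \<open>
  The pair \<open>(0, 2)\<close> is added separately, since the rule \<open>(i mod 3, i)\<close> would be a loop at \<open>i = 2\<close>.
\<close>

definition strip :: "nat \<Rightarrow> (nat \<times> nat) set" where
  "strip n = {(i - 1, i) | i. 1 \<le> i \<and> i \<le> n} \<union> {(i mod 3, i) | i. 3 \<le> i \<and> i \<le> n} \<union> {(0, 2)}"

definition strip_apex :: "nat \<Rightarrow> nat \<times> nat \<Rightarrow> nat" where
  "strip_apex n e = n + 1 + prod_encode e"

text \<open>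
  The vertices \<open>i \<ge> 3\<close> below the threshold \<open>m\<close> have the first color after \<open>i mod 3\<close> in the cyclic
  order of the colors, the others the second. On \<open>0, \<dots>, n\<close> all thresholds above \<open>n\<close> give the same
  coloring, represented by \<open>m = n + 1\<close>, and \<open>m \<ge> 4\<close> expresses that 3 is of the first kind.
\<close>

definition threshold_coloring :: "nat \<Rightarrow> nat \<Rightarrow> nat" where
  "threshold_coloring m i = (if i < 3 then i else if i < m then (i + 1) mod 3 else (i + 2) mod 3)"

lemma strip_less:
  assumes "(u, v) \<in> strip n" "3 \<le> n"
  shows "u < v" "v \<le> n"
proof -
  have "i mod 3 < i" if "3 \<le> i" for i :: nat
    using that by (meson less_le_trans mod_less_divisor zero_less_numeral)
  then show "u < v" "v \<le> n"
    using assms by (auto simp: strip_def)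
qed

lemma Field_strip:
  assumes "3 \<le> n"
  shows "Field (strip n) = {..n}"
proof
  show "Field (strip n) \<subseteq> {..n}"
    using strip_less[OF _ assms] by (fastforce simp: Field_def)
  have "i \<in> Field (strip n)" if "i \<le> n" for i
  proof (cases i)
    case 0
    have "(0, 2) \<in> strip n"
      by (simp add: strip_def)
    then show ?thesis
      using 0 by (auto simp: Field_def)
  next
    case (Suc j)
    then have "(j, i) \<in> strip n"
      using that unfolding strip_def by force
    then show ?thesis
      by (auto simp: Field_def)
  qed
  then show "{..n} \<subseteq> Field (strip n)"
    by auto
qed

lemma strip_triangle:
  assumes "3 \<le> n"
  shows "(0, 1) \<in> strip n" "(1, 2) \<in> strip n" "(0, 2) \<in> strip n"
  using assms unfolding strip_def by force+

lemma erected_triangles_strip: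
  assumes n: "3 \<le> n"
  shows "erected_triangles (strip n) (strip_apex n)"
proof
  let ?S = "strip n \<union> (strip n)\<inverse>"
  have "strip n \<subseteq> {..n} \<times> {..n}"
    using strip_less[OF _ n] by fastforce
  then show "finite (strip n)"
    by (rule finite_subset) simp
  show "(v, u) \<notin> strip n" if "(u, v) \<in> strip n" for u v
    using strip_less[OF that n] strip_less[OF _ n] by fastforce
  show "inj_on (strip_apex n) (strip n)"
    by (rule inj_onI) (simp add: strip_apex_def)
  show "strip_apex n e \<notin> Field (strip n)" if "e \<in> strip n" for e
    by (simp add: Field_strip[OF n] strip_apex_def)
  have from_0: "i \<le> n \<Longrightarrow> (0, i) \<in> ?S\<^sup>*" for i
  proof (induction i)
    case (Suc i)
    then have "(i, Suc i) \<in> ?S"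
      unfolding strip_def by force
    with Suc show ?case
      by (meson Suc_leD rtrancl.rtrancl_into_rtrancl)
  qed simp
  have "sym (?S\<^sup>*)"
    by (intro sym_rtrancl) (auto simp: sym_def)
  then show "(x, y) \<in> ?S\<^sup>*" if "x \<in> Field (strip n)" "y \<in> Field (strip n)" for x y
    using that from_0[of x] from_0[of y] unfolding Field_strip[OF n]
    by (meson atMost_iff rtrancl_trans symD)
  show "\<exists>(u, v)\<in>strip n. u \<in> S \<longleftrightarrow> v \<in> S" for S
  proof (rule ccontr)
    assume "\<not> ?thesis"
    then have "(u \<in> S) \<noteq> (v \<in> S)" if "(u, v) \<in> strip n" for u v
      using that by blast
    from this[OF strip_triangle(1)[OF n]] this[OF strip_triangle(2)[OF n]]
      this[OF strip_triangle(3)[OF n]]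
    show False
      by blast
  qed
qed

lemma threshold_coloring_proper:
  assumes "(u, v) \<in> strip n" "4 \<le> m"
  shows "threshold_coloring m u \<noteq> threshold_coloring m v"
proof -
  have "1 \<le> v \<and> u = v - 1 \<or> 3 \<le> v \<and> u = v mod 3 \<or> u = 0 \<and> v = 2"
    using assms(1) by (auto simp: strip_def)
  then consider "v \<in> {1, 2}" "u = v - 1" | "v = 3" "u = 2" | "v \<ge> 4" "u = v - 1"
    | "v \<ge> 3" "u = v mod 3" | "u = 0" "v = 2"
    by fastforce
  then show ?thesis
  proof cases
    case 3
    then obtain w where "u = w" "v = Suc w" "3 \<le> w"
      by (cases v) auto
    moreover have "(w + 1) mod 3 \<noteq> (Suc w + 1) mod 3" "(w + 2) mod 3 \<noteq> (Suc w + 2) mod 3"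
      "(w + 1) mod 3 \<noteq> (Suc w + 2) mod 3"
      by presburger+
    ultimately show ?thesis
      using assms(2) unfolding threshold_coloring_def by (simp del: add_Suc)
  next
    case 4
    moreover have "v mod 3 < 3"
      by simp
    moreover have "v mod 3 \<noteq> (v + 1) mod 3" "v mod 3 \<noteq> (v + 2) mod 3"
      by presburger+
    ultimately show ?thesis
      unfolding threshold_coloring_def by simp
  qed (use assms in \<open>auto simp: threshold_coloring_def\<close>)
qed

lemma third_color:
  fixes a j :: nat
  assumes "a < 3" "a \<noteq> j mod 3" "a \<noteq> (j + 2) mod 3"
  shows "a = (j + 1) mod 3"
proof -
  have "a = (r + 1) mod 3" if "r < 3" "a \<noteq> r" "a \<noteq> (r + 2) mod 3" for r
  proof -
    have "r = 0 \<or> r = 1 \<or> r = 2"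
      using that(1) by auto
    then show ?thesis
      using that assms(1) by (elim disjE) auto
  qed
  from this[of "j mod 3"] show ?thesis
    using assms by (simp only: mod_add_left_eq) simp
qed

text \<open>
  Induction along the path. After a vertex of the second kind only the second kind is possible, so
  the threshold stays; after a vertex of the first kind the next vertex either keeps the
  threshold, which is then its own number, or moves it up by one.
\<close>

lemma coloring_is_threshold:
  assumes c3: "\<And>i. i \<le> n \<Longrightarrow> c i < 3"
    and proper: "\<And>u v. (u, v) \<in> strip n \<Longrightarrow> c u \<noteq> c v"
    and start: "c 0 = 0" "c 1 = 1" "c 2 = 2" and n: "3 \<le> n"
  shows "\<exists>m\<in>{4..n + 1}. \<forall>i\<le>n. c i = threshold_coloring m i"
proof -
  have path: "c i \<noteq> c (Suc i)" if "Suc i \<le> n" for i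
    by (rule proper) (use that in \<open>force simp: strip_def\<close>)
  have chord: "c i \<noteq> i mod 3" if "3 \<le> i" "i \<le> n" for i
  proof -
    have "c (i mod 3) \<noteq> c i"
      by (rule proper) (use that in \<open>force simp: strip_def\<close>)
    moreover have "i mod 3 = 0 \<or> i mod 3 = 1 \<or> i mod 3 = 2"
      by presburger
    ultimately show ?thesis
      using start by auto
  qed
  have "\<exists>m\<in>{4..k + 1}. \<forall>i\<le>k. c i = threshold_coloring m i" if "3 \<le> k" "k \<le> n" for k
    using that
  proof (induction k rule: dec_induct)
    case base
    have "c 3 = 1"
      using path[of 2] chord[of 3] c3[of 3] start n by (simp add: numeral_eq_Suc less_Suc_eq)
    have "c i = threshold_coloring 4 i" if "i \<le> 3" for i
    proof -
      have "i = 0 \<or> i = 1 \<or> i = 2 \<or> i = 3"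
        using that by auto
      then show ?thesis
        using start \<open>c 3 = 1\<close> by (auto simp: threshold_coloring_def)
    qed
    then show ?case
      by (intro bexI[of _ 4]) auto
  next
    case (step k)
    then obtain m where m: "m \<in> {4..k + 1}" and eq: "\<And>i. i \<le> k \<Longrightarrow> c i = threshold_coloring m i"
      by auto
    have ck: "c k = threshold_coloring m k"
      using eq by simp
    have ne: "c (Suc k) \<noteq> c k" "c (Suc k) \<noteq> Suc k mod 3" "c (Suc k) < 3"
      using path[of k] chord[of "Suc k"] c3[of "Suc k"] step by auto
    show ?case
    proof (cases "c (Suc k) = (Suc k + 2) mod 3")
      case True
      have "c i = threshold_coloring m i" if "i \<le> Suc k" for i
        using that eq[of i] True m step(1) by (cases "i = Suc k") (auto simp: threshold_coloring_def)
      then show ?thesis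
        using m by (intro bexI[of _ m]) auto
    next
      case False
      then have new: "c (Suc k) = (Suc k + 1) mod 3"
        using third_color ne(2,3) by blast
      have "m = k + 1"
      proof (rule ccontr)
        assume "m \<noteq> k + 1"
        then have "c k = (k + 2) mod 3"
          using ck m step(1) by (simp add: threshold_coloring_def)
        then show False
          using ne(1) new by simp
      qed
      then have "c i = threshold_coloring (k + 2) i" if "i \<le> Suc k" for i
        using that eq[of i] new step(1) by (cases "i = Suc k") (auto simp: threshold_coloring_def)
      then show ?thesis
        using m by (intro bexI[of _ "k + 2"]) auto
    qed
  qed
  then show ?thesis
    using n by blast
qed

lemma normalized_colorings_strip:
  assumes n: "3 \<le> n"
  shows "erected_triangles.normalized_colorings (strip n) 0 1 2
    = (\<lambda>m. restrict (threshold_coloring m) {..n}) ` {4..n + 1}" (is "?L = ?R")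
proof -
  interpret erected_triangles "strip n" "strip_apex n"
    using erected_triangles_strip[OF n] .
  have "normalized_colorings 0 1 2 = ?R"
  proof (intro set_eqI iffI)
    fix c assume c: "c \<in> normalized_colorings 0 1 2"
    then have ext: "c \<in> extensional {..n}" and c3: "\<And>i. i \<le> n \<Longrightarrow> c i \<in> {0, 1, 2}"
      by (auto simp: normalized_colorings_def Field_strip[OF n] PiE_iff)
    have "c i < 3" if "i \<le> n" for i
      using c3[OF that] by auto
    moreover have "c u \<noteq> c v" if "(u, v) \<in> strip n" for u v
      using that c by (auto simp: normalized_colorings_def)
    moreover have "c 0 = 0" "c 1 = 1" "c 2 = 2"
      using c by (auto simp: normalized_colorings_def)
    ultimately obtain m where m: "m \<in> {4..n + 1}" "\<forall>i\<le>n. c i = threshold_coloring m i"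
      using coloring_is_threshold[of n c] n by blast
    have "c = restrict (threshold_coloring m) {..n}"
      by (rule extensionalityI[OF ext]) (use m in auto)
    then show "c \<in> ?R"
      using m by blast
  next
    fix c assume "c \<in> ?R"
    then obtain m where m: "m \<in> {4..n + 1}" "c = restrict (threshold_coloring m) {..n}"
      by blast
    have "j < 3 \<Longrightarrow> j \<in> {0, 1, 2}" for j :: nat
      by auto
    then have "threshold_coloring m i \<in> {0, 1, 2}" for i
      by (simp add: threshold_coloring_def)
    then have "c \<in> {..n} \<rightarrow>\<^sub>E {0, 1, 2}"
      unfolding m(2) by (intro restrict_PiE_iff[THEN iffD2] ballI)
    moreover have "c u \<noteq> c v" if "(u, v) \<in> strip n" for u v
      using threshold_coloring_proper[OF that, of m] m strip_less[OF that n] by auto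
    moreover have "c 0 = 0" "c 1 = 1" "c 2 = 2"
      using m n by (simp_all add: threshold_coloring_def)
    ultimately show "c \<in> normalized_colorings 0 1 2"
      unfolding normalized_colorings_def Field_strip[OF n] by blast
  qed
  then show ?thesis .
qed

text \<open>Colorings with thresholds \<open>m < m'\<close> differ at the vertex \<open>m\<close>.\<close>

lemma card_normalized_colorings_strip:
  assumes n: "3 \<le> n"
  shows "card (erected_triangles.normalized_colorings (strip n) 0 1 2) = n - 2"
proof -
  have differ: "restrict (threshold_coloring m) {..n} \<noteq> restrict (threshold_coloring m') {..n}"
    if "4 \<le> m" "m < m'" "m' \<le> n + 1" for m m'
  proof
    assume "restrict (threshold_coloring m) {..n} = restrict (threshold_coloring m') {..n}"
    then have "restrict (threshold_coloring m) {..n} m = restrict (threshold_coloring m') {..n} m"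
      by simp
    then have "(m + 2) mod 3 = (m + 1) mod 3"
      using that by (simp add: threshold_coloring_def)
    then show False
      by presburger
  qed
  have "inj_on (\<lambda>m. restrict (threshold_coloring m) {..n}) {4..n + 1}"
    by (rule linorder_inj_onI') (use differ in auto)
  then show ?thesis
    unfolding normalized_colorings_strip[OF n] by (simp add: card_image)
qed

theorem theorem1:
  fixes s :: nat
  assumes "s > 0"
  shows "\<exists>G :: nat pair_pre_digraph. pair_graph G \<and> pverts G \<noteq> {} \<and>
           card {P. irreducible_fat_coloring G P} = s"
proof -
  define n where "n = s + 2"
  have n: "3 \<le> n"
    using assms by (simp add: n_def)
  interpret erected_triangles "strip n" "strip_apex n"
    using erected_triangles_strip[OF n] .
  have card: "card (normalized_colorings 0 1 2) = s"
    using card_normalized_colorings_strip[OF n] by (simp add: n_def)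
  then have "normalized_colorings 0 1 2 \<noteq> {}"
    using assms by auto
  then have "card {P. irreducible_fat_coloring G P} = s"
    using card_irreducible_fat_colorings strip_triangle[OF n] card by simp
  then show ?thesis
    using pair_graph_G V_nonempty by (intro exI[of _ G]) simp
qed

end
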